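(* Let $\Sigma_1=(G_1,\sigma_1)$ be a finite, simple, connected, balanced signed graph and let $\Sigma_2=(K_n,\sigma_2)$ be a signed complete graph. Then the BCD-lexicographic product satisfies $\operatorname{bdim}(\Sigma_1*\Sigma_2)=\operatorname{bdim}(\Sigma_2)$.
   Context: A signed graph $\Sigma=(G,\sigma)$ is a graph $G=(V,E)$ with a function $\sigma:E\to\{+1,-1\}$. All graphs are finite, simple, connected and undirected unless otherwise mentioned. The sign of a cycle is the product of the signs of its edges; $\Sigma$ is balanced if it has no cycle of sign $-1$. A signed complete graph is a signed graph whose underlying graph is a complete graph $K_n$ (with arbitrary signature). Let $\Omega=\{-1,0,1\}$, with $\Omega^k\subset\mathbb{R}^k$ carrying the standard inner product $\langle\cdot,\cdot\rangle$. A vector valued switching function ($k$-switching function) for $\Sigma$ is a map $\zeta:V\to\Omega^k$ with $\langle\zeta(u),\zeta(v)\rangle\neq 0$ for every edge $uv\in E$; the switched signed graph $\Sigma^\zeta=(G,\sigma^\zeta)$ has $\sigma^\zeta(uv)=\sigma(uv)\operatorname{sgn}(\langle\zeta(u),\zeta(v)\rangle)$. The balancing dimension $\operatorname{bdim}(\Sigma)$ is the least integer $k\ge 1$ for which there is a $k$-switching function $\zeta:V\to\Omega^k$ such that $\Sigma^\zeta$ is all-positive (every edge has sign $+1$). The lexicographic product of graphs $G_1,G_2$ has vertex set $V(G_1)\times V(G_2)$, with $(u_i,v_j)$ adjacent to $(u_k,v_l)$ iff $u_i\sim u_k$ in $G_1$, or $u_i=u_k$ and $v_j\sim v_l$ in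 $G_2$. The BCD-lexicographic product $\Sigma_1*\Sigma_2$ of $\Sigma_1=(G_1,\sigma_1)$ and $\Sigma_2=(G_2,\sigma_2)$ is the signed graph on this lexicographic product with signature $$\sigma((u_i,v_j)(u_k,v_l))=\begin{cases}\sigma_1(u_iu_k) & \text{if } u_i\sim u_k \text{ and } v_j\nsim v_l,\\ \sigma_1(u_iu_k)\sigma_2(v_jv_l) & \text{if } u_i\sim u_k\text{ and } v_j\sim v_l,\\ \sigma_2(v_jv_l) & \text{if } u_i=u_k \text{ and } v_j\sim v_l,\end{cases}$$ where $v_j\nsim v_l$ includes the case $v_j=v_l$. *)

theory Defs
  imports Complex_Main "Graph_Theory.Graph_Theory"
begin

text \<open>
  As in the library, a finite simple undirected graph is a finite loop-free digraph without
  parallel arcs whose arc relation is symmetric (locale \<^locale>\<open>pair_graph\<close>): the undirected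
  edge \<open>uv\<close> is the pair of arcs \<open>(u,v)\<close>, \<open>(v,u)\<close>. Accordingly, a signature on the edges is a
  function on arcs which takes the same value on \<open>(u,v)\<close> and \<open>(v,u)\<close>; its values off the arcs
  are irrelevant.
\<close>

record 'a sgraph =
  ugraph :: "'a pair_pre_digraph"
  sig :: "'a \<times> 'a \<Rightarrow> real"

definition signed_graph :: "'a sgraph \<Rightarrow> bool" where
  "signed_graph S \<longleftrightarrow> pair_graph (ugraph S) \<and>
     (\<forall>(u, v) \<in> parcs (ugraph S). sig S (u, v) \<in> {1, -1} \<and> sig S (v, u) = sig S (u, v))"

text \<open>
  The library's directed notion of cycle also admits \<open>u, v, u\<close>; requiring at least three arcs
  leaves exactly the two orientations (and all starting points) of the undirected cycles.
\<close>

definition graph_cycle :: "'a pair_pre_digraph \<Rightarrow> ('a \<times> 'a) list \<Rightarrow> bool" where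
  "graph_cycle G p \<longleftrightarrow> pre_digraph.cycle (with_proj G) p \<and> 3 \<le> length p"

definition cycle_sign :: "'a sgraph \<Rightarrow> ('a \<times> 'a) list \<Rightarrow> real" where
  "cycle_sign S p = prod_list (map (sig S) p)"

definition balanced :: "'a sgraph \<Rightarrow> bool" where
  "balanced S \<longleftrightarrow> \<not> (\<exists>p. graph_cycle (ugraph S) p \<and> cycle_sign S p = -1)"

definition Omega :: "real set" where
  "Omega = {-1, 0, 1}"

text \<open>
  The dimension \<open>k\<close> is a bound variable in the balancing dimension, so a vector of length \<open>k\<close>
  is a function on \<^typ>\<open>nat\<close> of which only the coordinates \<open>i < k\<close> are used.
\<close>

definition inner_prod :: "nat \<Rightarrow> (nat \<Rightarrow> real) \<Rightarrow> (nat \<Rightarrow> real) \<Rightarrow> real" where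
  "inner_prod k x y = (\<Sum>i<k. x i * y i)"

definition switching_function :: "nat \<Rightarrow> 'a sgraph \<Rightarrow> ('a \<Rightarrow> nat \<Rightarrow> real) \<Rightarrow> bool" where
  "switching_function k S \<zeta> \<longleftrightarrow>
     (\<forall>u \<in> pverts (ugraph S). \<forall>i<k. \<zeta> u i \<in> Omega) \<and>
     (\<forall>(u, v) \<in> parcs (ugraph S). inner_prod k (\<zeta> u) (\<zeta> v) \<noteq> 0)"

definition switched :: "nat \<Rightarrow> ('a \<Rightarrow> nat \<Rightarrow> real) \<Rightarrow> 'a sgraph \<Rightarrow> 'a sgraph" where
  "switched k \<zeta> S =
     \<lparr> ugraph = ugraph S,
       sig = (\<lambda>(u, v). sig S (u, v) * sgn (inner_prod k (\<zeta> u) (\<zeta> v))) \<rparr>"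

definition all_positive :: "'a sgraph \<Rightarrow> bool" where
  "all_positive S \<longleftrightarrow> (\<forall>e \<in> parcs (ugraph S). sig S e = 1)"

text \<open>
  For a signed graph the set of admissible \<open>k\<close> is never empty: use one coordinate per edge,
  equal to \<open>1\<close> at one end, to the sign of the edge at the other end, and to \<open>0\<close> elsewhere
  (and \<open>k = 1\<close> if there are no edges).
\<close>

definition bdim :: "'a sgraph \<Rightarrow> nat" where
  "bdim S = (LEAST k. 1 \<le> k \<and>
     (\<exists>\<zeta>. switching_function k S \<zeta> \<and> all_positive (switched k \<zeta> S)))"

definition lex_product ::
  "'a pair_pre_digraph \<Rightarrow> 'b pair_pre_digraph \<Rightarrow> ('a \<times> 'b) pair_pre_digraph" where
  "lex_product G H =
     \<lparr> pverts = pverts G \<times> pverts H,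
       parcs = {((u, v), (u', v')).
         (u, v) \<in> pverts G \<times> pverts H \<and> (u', v') \<in> pverts G \<times> pverts H \<and>
         ((u, u') \<in> parcs G \<or> (u = u' \<and> (v, v') \<in> parcs H))} \<rparr>"

definition bcd_lex_product :: "'a sgraph \<Rightarrow> 'b sgraph \<Rightarrow> ('a \<times> 'b) sgraph" where
  "bcd_lex_product S T =
     \<lparr> ugraph = lex_product (ugraph S) (ugraph T),
       sig = (\<lambda>((u, v), (u', v')).
         if (u, u') \<in> parcs (ugraph S)
         then (if (v, v') \<in> parcs (ugraph T)
               then sig S (u, u') * sig T (v, v')
               else sig S (u, u'))
         else sig T (v, v')) \<rparr>"

lemma signed_graph_bcd_lex_product:
  assumes "signed_graph S" "signed_graph T"
  shows "signed_graph (bcd_lex_product S T)"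
proof -
  let ?G = "ugraph S" and ?H = "ugraph T" and ?P = "lex_product (ugraph S) (ugraph T)"
  interpret G: pair_graph ?G using assms(1) by (simp add: signed_graph_def)
  interpret H: pair_graph ?H using assms(2) by (simp add: signed_graph_def)
  have sub: "parcs ?P \<subseteq> (pverts ?G \<times> pverts ?H) \<times> (pverts ?G \<times> pverts ?H)"
    by (auto simp: lex_product_def)
  have "pair_graph ?P"
  proof
    show "finite (pverts ?P)"
      by (simp add: lex_product_def G.pair_finite_verts H.pair_finite_verts)
    show "finite (parcs ?P)"
      by (rule finite_subset[OF sub]) (simp add: G.pair_finite_verts H.pair_finite_verts)
    show "symmetric (with_proj ?P)"
      by (auto simp: symmetric_def lex_product_def intro!: symI
          dest: G.arcs_symmetric H.arcs_symmetric)
  next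
    fix e assume "e \<in> parcs ?P"
    then show "fst e \<noteq> snd e"
      by (auto simp: lex_product_def dest: G.pair_no_loops H.pair_no_loops)
  qed (auto simp: lex_product_def)
  moreover have "(u', u) \<in> parcs ?G \<longleftrightarrow> (u, u') \<in> parcs ?G" for u u'
    using G.arcs_symmetric by blast
  moreover have "(v', v) \<in> parcs ?H \<longleftrightarrow> (v, v') \<in> parcs ?H" for v v'
    using H.arcs_symmetric by blast
  ultimately show ?thesis
    using assms unfolding signed_graph_def bcd_lex_product_def
    by (fastforce simp: lex_product_def dest: G.pair_no_loops)
qed

end

theory Submission
  imports Defs
begin

text \<open>
  A connected balanced signed graph has a potential \<open>s\<close> with values \<open>\<plusminus>1\<close>, i.e.
  \<open>\<sigma>\<^sub>1(u u') = s(u) s(u')\<close> on every edge.  If \<open>\<zeta>\<close> balances the complete factor in dimension \<open>k\<close>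
  and has no zero vector, then \<open>(u, v) \<mapsto> s(u) \<zeta>(v)\<close> balances the product in the same dimension:
  completeness of the second factor means that non-adjacent \<open>v, v'\<close> coincide, and then the inner
  product is a positive multiple of \<open>s(u) s(u')\<close>.  Conversely the product contains copies of the
  second factor.
\<close>

lemma cycle_sign_Nil [simp]: "cycle_sign S [] = 1"
  by (simp add: cycle_sign_def)

lemma cycle_sign_Cons [simp]: "cycle_sign S (e # p) = sig S e * cycle_sign S p"
  by (simp add: cycle_sign_def)

lemma cycle_sign_append [simp]: "cycle_sign S (p @ q) = cycle_sign S p * cycle_sign S q"
  by (simp add: cycle_sign_def)

lemma sig_values:
  assumes "signed_graph S" "e \<in> parcs (ugraph S)"
  shows "sig S e = 1 \<or> sig S e = -1"
  using assms by (cases e) (auto simp: signed_graph_def)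

lemma cycle_sign_values:
  assumes "signed_graph S" "set p \<subseteq> parcs (ugraph S)"
  shows "cycle_sign S p = 1 \<or> cycle_sign S p = -1"
  using assms(2)
proof (induction p)
  case (Cons e p)
  then show ?case
    using sig_values[OF assms(1), of e] by auto
qed simp

text \<open>Balance only constrains cycles, so induct on the length. A closed walk that revisits a
  vertex splits into two shorter closed walks whose signs multiply to its own. One without such a
  repetition is a genuine cycle, or runs along one edge and back, which contributes the square of a
  sign.\<close>

lemma balanced_closed_walk_sign:
  assumes S: "signed_graph S" and bal: "balanced S"
    and walk: "pre_digraph.awalk (with_proj (ugraph S)) u p u"
  shows "cycle_sign S p = 1"
proof -
  interpret pair_graph "ugraph S"
    using S by (simp add: signed_graph_def)
  show ?thesis
    using walk
  proof (induction "length p" arbitrary: u p rule: less_induct)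
    case less
    note walk = \<open>awalk u p u\<close>
    show ?case
    proof (cases p)
      case Nil
      then show ?thesis by simp
    next
      case (Cons e es)
      with walk have e: "e \<in> parcs (ugraph S)" "u = fst e" and es: "awalk (snd e) es u"
        by (auto simp: awalk_Cons_iff)
      show ?thesis
      \<comment> \<open>The vertices of \<open>es\<close> are those of \<open>p\<close> without the
        first occurrence of \<open>u\<close>; their distinctness is exactly what
        \<open>cycle\<close> demands of a closed walk.\<close>
      proof (cases "distinct (pawalk_verts (snd e) es)")
        case True
        then have cyc: "cycle p"
          using walk Cons by (auto simp: cycle_def)
        show ?thesis
        proof (cases "3 \<le> length p")
          case True
          with cyc bal have "cycle_sign S p \<noteq> -1"
            by (auto simp: balanced_def graph_cycle_def)
          moreover have "set p \<subseteq> parcs (ugraph S)"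
            using walk by (auto simp: awalk_def)
          ultimately show ?thesis
            using cycle_sign_values[OF S] by blast
        next
          case False
          \<comment> \<open>Otherwise \<open>e\<close> alone would be a closed walk, hence a loop.
            So \<open>p\<close> has exactly two arcs, \<open>e\<close> and its reverse.\<close>
          have "es \<noteq> []"
            using e es pair_no_loops[OF e(1)] by (auto simp: awalk_Nil_iff)
          with False Cons have "length es = Suc 0"
            by (cases es) (auto simp: not_less_eq_eq)
          then obtain f where f: "es = [f]"
            by (auto simp: length_Suc_conv)
          with es e have "f = (snd e, fst e)"
            by (auto simp: awalk_Cons_iff awalk_Nil_iff prod_eq_iff)
          moreover have "sig S (snd e, fst e) = sig S e"
            using S e by (cases e) (auto simp: signed_graph_def)
          ultimately show ?thesis
            using sig_values[OF S e(1)] Cons f by auto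
        qed
      next
        case False
        with awalk_not_distinct_decomp[OF es] obtain q r t w
          where es_eq: "es = q @ r @ t" and "0 < length r"
            and w: "awalk (snd e) q w" "awalk w r w" "awalk w t u"
          by blast
        \<comment> \<open>The detour \<open>r\<close> at the repeated vertex \<open>w\<close> is cut
          out. The remainder is shorter than \<open>p\<close> because \<open>r\<close> is nonempty,
          and \<open>r\<close> is shorter because it does not contain \<open>e\<close>.\<close>
        have "awalk u (e # q @ t) u"
          using w e by (auto simp: awalk_Cons_iff intro: awalk_appendI)
        then have "cycle_sign S (e # q @ t) = 1"
          using es_eq Cons \<open>0 < length r\<close> by (intro less.hyps) auto
        moreover have "cycle_sign S r = 1"
          using es_eq Cons by (intro less.hyps[OF _ w(2)]) auto
        ultimately show ?thesis
          using es_eq Cons by (simp add: mult.assoc)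
      qed
    qed
  qed
qed

text \<open>Fix a root and let \<open>s u\<close> be the sign of a chosen walk from the root to
  \<open>u\<close>. Closed walks have sign 1, so the choice of walk does not affect the value, and
  appending an edge multiplies it by the sign of that edge.\<close>

lemma balanced_potential:
  assumes S: "signed_graph S" and bal: "balanced S"
    and con: "Digraph_Component.connected (with_proj (ugraph S))"
  obtains s :: "'a \<Rightarrow> real" where
    "\<And>u. u \<in> pverts (ugraph S) \<Longrightarrow> s u = 1 \<or> s u = -1"
    "\<And>u v. (u, v) \<in> parcs (ugraph S) \<Longrightarrow> sig S (u, v) = s u * s v"
proof -
  interpret pair_graph "ugraph S"
    using S by (simp add: signed_graph_def)
  have sc: "strongly_connected (with_proj (ugraph S))"
    using symmetric_connected_imp_strongly_connected[OF pair_sym_arcs con] .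
  then obtain r where r: "r \<in> pverts (ugraph S)"
    by (auto simp: strongly_connected_def)
  have walks: "\<exists>p. awalk u p v" if "u \<in> pverts (ugraph S)" "v \<in> pverts (ugraph S)" for u v
    using sc that by (auto simp: strongly_connected_def reachable_awalk)
  define P where "P u = (SOME p. awalk r p u)" for u
  have P: "awalk r (P u) u" if "u \<in> pverts (ugraph S)" for u
    unfolding P_def using walks[OF r that] by (rule someI_ex)
  have val: "cycle_sign S (P u) = 1 \<or> cycle_sign S (P u) = -1" if "u \<in> pverts (ugraph S)" for u
    using cycle_sign_values[OF S] P[OF that] by (auto simp: awalk_def)
  have "sig S (u, v) = cycle_sign S (P u) * cycle_sign S (P v)"
    if uv: "(u, v) \<in> parcs (ugraph S)" for u v
  proof -
    have u: "u \<in> pverts (ugraph S)" and v: "v \<in> pverts (ugraph S)"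
      using uv by (auto dest: wellformed')
    \<comment> \<open>The same way back \<open>q\<close> closes both the walk to \<open>u\<close>
      extended by the edge and the chosen walk to \<open>v\<close>. Both closed walks have sign 1,
      and comparing them gives the sign of the edge.\<close>
    obtain q where q: "awalk v q r"
      using walks[OF v r] by blast
    have "awalk u ((u, v) # q) r"
      using q uv by (auto simp: awalk_Cons_iff)
    then have "cycle_sign S (P u @ (u, v) # q) = 1"
      using P[OF u] by (intro balanced_closed_walk_sign[OF S bal] awalk_appendI)
    moreover have "cycle_sign S (P v @ q) = 1"
      using P[OF v] q by (intro balanced_closed_walk_sign[OF S bal] awalk_appendI)
    ultimately show ?thesis
      using val[OF u] val[OF v] by auto
  qed
  with val show thesis
    by (intro that[of "\<lambda>u. cycle_sign S (P u)"])
qed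

text \<open>As signs are 1 or -1, a product of two signs is 1 iff they agree. Agreement also forces
  a nonzero inner product, since \<open>sgn 0 = 0\<close>, so one condition per arc covers both
  requirements.\<close>

lemma switching_all_positive_iff:
  assumes "signed_graph S"
  shows "switching_function k S \<zeta> \<and> all_positive (switched k \<zeta> S) \<longleftrightarrow>
    (\<forall>u \<in> pverts (ugraph S). \<forall>i<k. \<zeta> u i \<in> Omega) \<and>
    (\<forall>(u, v) \<in> parcs (ugraph S). sgn (inner_prod k (\<zeta> u) (\<zeta> v)) = sig S (u, v))"
proof -
  have "inner_prod k (\<zeta> u) (\<zeta> v) \<noteq> 0 \<and> sig (switched k \<zeta> S) (u, v) = 1 \<longleftrightarrow>
      sgn (inner_prod k (\<zeta> u) (\<zeta> v)) = sig S (u, v)" if "(u, v) \<in> parcs (ugraph S)" for u v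
    using sig_values[OF assms that] by (auto simp: switched_def sgn_real_def)
  moreover have "ugraph (switched k \<zeta> S) = ugraph S"
    by (simp add: switched_def)
  ultimately show ?thesis
    unfolding switching_function_def all_positive_def by fastforce
qed

lemma inner_prod_scale:
  "inner_prod k (\<lambda>i. a * x i) (\<lambda>i. b * y i) = a * b * inner_prod k x y"
  by (simp add: inner_prod_def sum_distrib_left algebra_simps)

lemma inner_prod_self_pos:
  assumes "i < k" "x i \<noteq> 0"
  shows "0 < inner_prod k x x"
  unfolding inner_prod_def
  by (rule sum_pos2[of _ i]) (use assms in \<open>auto simp: zero_less_mult_iff\<close>)

lemma balancing_product:
  assumes S: "signed_graph S" and bal: "balanced S"
    and con: "Digraph_Component.connected (with_proj (ugraph S))"
    and T: "signed_graph T" and compl: "complete_digraph n (with_proj (ugraph T))"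
    and k: "1 \<le> k"
    and \<zeta>: "switching_function k T \<zeta> \<and> all_positive (switched k \<zeta> T)"
  shows "\<exists>\<xi>. switching_function k (bcd_lex_product S T) \<xi> \<and>
    all_positive (switched k \<xi> (bcd_lex_product S T))"
proof -
  obtain s :: "'a \<Rightarrow> real" where
    s: "\<And>u. u \<in> pverts (ugraph S) \<Longrightarrow> s u = 1 \<or> s u = -1" and
    ss: "\<And>u v. (u, v) \<in> parcs (ugraph S) \<Longrightarrow> sig S (u, v) = s u * s v"
    using balanced_potential[OF S bal con] by blast
  \<comment> \<open>An isolated vertex (the case \<open>n = 1\<close>) may carry the zero vector.\<close>
  define \<eta> where "\<eta> v = (if \<forall>i<k. \<zeta> v i = 0 then \<lambda>_. 1 else \<zeta> v)" for v
  have \<eta>_Omega: "\<eta> v i \<in> Omega" if "v \<in> pverts (ugraph T)" "i < k" for v i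
    using \<zeta> that by (auto simp: \<eta>_def switching_function_def Omega_def)
  have \<eta>_self: "inner_prod k (\<eta> v) (\<eta> v) > 0" for v
  proof (cases "\<forall>i<k. \<zeta> v i = 0")
    case True
    \<comment> \<open>Since \<open>1 \<le> k\<close>, coordinate 0 exists, and the constant vector 1
      is nonzero there.\<close>
    then show ?thesis
      using k by (intro inner_prod_self_pos[of 0]) (auto simp: \<eta>_def)
  next
    case False
    then obtain i where "i < k" "\<zeta> v i \<noteq> 0"
      by blast
    then show ?thesis
      by (intro inner_prod_self_pos[of i]) (auto simp: \<eta>_def)
  qed
  have \<eta>_sgn: "sgn (inner_prod k (\<eta> v) (\<eta> v')) = sig T (v, v')"
    if vv: "(v, v') \<in> parcs (ugraph T)" for v v'
  proof -
    \<comment> \<open>Neither end of an arc can carry the zero vector, so the replacement in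
      \<open>\<eta>\<close> leaves both ends unchanged.\<close>
    have "inner_prod k (\<zeta> v) (\<zeta> v') \<noteq> 0"
      using \<zeta> vv by (auto simp: switching_function_def)
    then have "\<not> (\<forall>i<k. \<zeta> v i = 0)" "\<not> (\<forall>i<k. \<zeta> v' i = 0)"
      by (metis (no_types, lifting) inner_prod_def lessThan_iff mult_eq_0_iff sum.neutral)+
    then have "\<eta> v = \<zeta> v" "\<eta> v' = \<zeta> v'"
      by (simp_all only: \<eta>_def if_False)
    then show ?thesis
      using \<zeta> vv unfolding switching_all_positive_iff[OF T] by auto
  qed
  have parcs_T: "parcs (ugraph T) = {(v, v'). (v, v') \<in> pverts (ugraph T) \<times> pverts (ugraph T) \<and> v \<noteq> v'}"
    using compl by (simp add: complete_digraph_pair_def)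
  define \<xi> where "\<xi> = (\<lambda>(u, v) i. s u * \<eta> v i)"
  have inner: "inner_prod k (\<xi> (u, v)) (\<xi> (u', v')) = s u * s u' * inner_prod k (\<eta> v) (\<eta> v')"
    for u v u' v'
    by (simp add: \<xi>_def inner_prod_scale)
  interpret pair_graph "ugraph S"
    using S by (simp add: signed_graph_def)
  have Omega: "\<xi> x i \<in> Omega" if "x \<in> pverts (ugraph (bcd_lex_product S T))" "i < k" for x i
  proof -
    obtain u v where x: "x = (u, v)" by (cases x)
    then have "u \<in> pverts (ugraph S)" "v \<in> pverts (ugraph T)"
      using that by (auto simp: bcd_lex_product_def lex_product_def)
    then show ?thesis
      using s[of u] \<eta>_Omega[of v i] \<open>i < k\<close> x by (auto simp: \<xi>_def Omega_def)
  qed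
  have sgns: "sgn (inner_prod k (\<xi> x) (\<xi> y)) = sig (bcd_lex_product S T) (x, y)"
    if "(x, y) \<in> parcs (ugraph (bcd_lex_product S T))" for x y
  proof -
    obtain u v u' v' where x: "x = (u, v)" and y: "y = (u', v')" by (cases x, cases y)
    have verts: "u \<in> pverts (ugraph S)" "u' \<in> pverts (ugraph S)"
      "v \<in> pverts (ugraph T)" "v' \<in> pverts (ugraph T)"
      and arc: "(u, u') \<in> parcs (ugraph S) \<or> u = u' \<and> (v, v') \<in> parcs (ugraph T)"
      using that x y by (auto simp: bcd_lex_product_def lex_product_def)
    have sgn_s: "sgn (s u * s u') = s u * s u'" and s_self: "s u * s u = 1"
      using s[OF verts(1)] s[OF verts(2)] by auto
    consider (both) "(u, u') \<in> parcs (ugraph S)" "(v, v') \<in> parcs (ugraph T)"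
      | (left) "(u, u') \<in> parcs (ugraph S)" "(v, v') \<notin> parcs (ugraph T)"
      | (right) "u = u'" "(u, u') \<notin> parcs (ugraph S)" "(v, v') \<in> parcs (ugraph T)"
      using arc by blast
    then show ?thesis
    proof cases
      case both
      then show ?thesis
        by (simp add: x y inner sgn_mult[of "s u * s u'"] sgn_s \<eta>_sgn ss bcd_lex_product_def)
    next
      case left
      \<comment> \<open>By completeness, distinct vertices are adjacent. The inner product becomes
        \<open>s u * s u'\<close> times the positive number
        \<open>inner_prod k (\<eta> v) (\<eta> v)\<close>.\<close>
      then have "v = v'"
        using verts parcs_T by auto
      then show ?thesis
        using left \<eta>_self[of v]
        by (simp add: x y inner sgn_mult[of "s u * s u'"] sgn_s ss bcd_lex_product_def)
    next
      case right
      then show ?thesis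
        using s_self by (simp add: x y inner \<eta>_sgn bcd_lex_product_def)
    qed
  qed
  show ?thesis
    unfolding switching_all_positive_iff[OF signed_graph_bcd_lex_product[OF S T]]
    using Omega sgns by blast
qed

text \<open>The fibre over \<open>u\<close> is a copy of the second factor with its own signature,
  so a balancing function of the product restricts to one for \<open>T\<close>.\<close>

lemma balancing_right_factor:
  assumes S: "signed_graph S" and T: "signed_graph T" and u: "u \<in> pverts (ugraph S)"
    and \<xi>: "switching_function k (bcd_lex_product S T) \<xi> \<and>
      all_positive (switched k \<xi> (bcd_lex_product S T))"
  shows "\<exists>\<zeta>. switching_function k T \<zeta> \<and> all_positive (switched k \<zeta> T)"
proof -
  interpret S: pair_graph "ugraph S"
    using S by (simp add: signed_graph_def)
  interpret T: pair_graph "ugraph T"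
    using T by (simp add: signed_graph_def)
  \<comment> \<open>The product signature tests adjacency in \<open>S\<close> first; without a loop
    at \<open>u\<close>, arcs inside the fibre take their sign from \<open>T\<close> alone.\<close>
  have loop: "(u, u) \<notin> parcs (ugraph S)"
    using S.pair_no_loops by force
  have "((u, v), (u, v')) \<in> parcs (ugraph (bcd_lex_product S T)) \<and>
      sig (bcd_lex_product S T) ((u, v), (u, v')) = sig T (v, v')"
    if "(v, v') \<in> parcs (ugraph T)" for v v'
    using that u loop by (auto simp: bcd_lex_product_def lex_product_def dest: T.wellformed')
  moreover have "(u, v) \<in> pverts (ugraph (bcd_lex_product S T))" if "v \<in> pverts (ugraph T)" for v
    using that u by (simp add: bcd_lex_product_def lex_product_def)
  ultimately have "switching_function k T (\<lambda>v. \<xi> (u, v)) \<and> all_positive (switched k (\<lambda>v. \<xi> (u, v)) T)"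
    using \<xi>
    unfolding switching_all_positive_iff[OF T]
      switching_all_positive_iff[OF signed_graph_bcd_lex_product[OF S T]]
    by fastforce
  then show ?thesis
    by blast
qed

theorem theorem2p24:
  fixes \<Sigma>\<^sub>1 :: "'a sgraph" and \<Sigma>\<^sub>2 :: "'b sgraph" and n :: nat
  assumes "signed_graph \<Sigma>\<^sub>1"
    and "Digraph_Component.connected (with_proj (ugraph \<Sigma>\<^sub>1))"
    and "balanced \<Sigma>\<^sub>1"
    and "signed_graph \<Sigma>\<^sub>2"
    and "n \<ge> 1"
    and "complete_digraph n (with_proj (ugraph \<Sigma>\<^sub>2))"
  shows "bdim (bcd_lex_product \<Sigma>\<^sub>1 \<Sigma>\<^sub>2) = bdim \<Sigma>\<^sub>2"
proof -
  \<comment> \<open>Connectedness includes having a vertex, so there is a fibre to restrict to. Both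
    graphs then admit the same dimensions \<open>k\<close> with \<open>1 \<le> k\<close>, and the
    least ones coincide.\<close>
  obtain u where "u \<in> pverts (ugraph \<Sigma>\<^sub>1)"
    using assms(2) by (auto simp: connected_def strongly_connected_def)
  then have "(\<exists>\<zeta>. switching_function k (bcd_lex_product \<Sigma>\<^sub>1 \<Sigma>\<^sub>2) \<zeta> \<and>
        all_positive (switched k \<zeta> (bcd_lex_product \<Sigma>\<^sub>1 \<Sigma>\<^sub>2))) \<longleftrightarrow>
      (\<exists>\<zeta>. switching_function k \<Sigma>\<^sub>2 \<zeta> \<and> all_positive (switched k \<zeta> \<Sigma>\<^sub>2))" if "1 \<le> k" for k
    using balancing_product[OF assms(1,3,2,4,6) that] balancing_right_factor[OF assms(1,4)] by blast
  then show ?thesis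
    unfolding bdim_def by (metis (no_types, lifting))
qed

end
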